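(* Let $q$ be a prime power, $n \geq 1$, and let $f(x_1,\dots,x_n) = (f_1(x_1,\dots,x_n),\dots,f_n(x_1,\dots,x_n))$ with each $f_i \in \mathbb{F}_q[x_1,\dots,x_n]$, viewed as a map $f:\mathbb{F}_q^n \to \mathbb{F}_q^n$. Let $V_f = f(\mathbb{F}_q^n)$ be its value set. If $|V_f| < q^n$, then $$|V_f| \leq q^n - \min\{q,\ \mu_f (q-1)\},$$ where $\mu_f$ is defined in the context.
   Context: Newton polytope: for a field $F$ and $h = \sum_{j=1}^m a_j x_1^{v_{1j}}\cdots x_n^{v_{nj}} \in F[x_1,\dots,x_n]$ with all $a_j \neq 0$ and $V_j=(v_{1j},\dots,v_{nj}) \in \mathbb{Z}_{\ge 0}^n$, the Newton polytope $\Delta(h)$ is the convex hull in $\mathbb{R}^n$ of $\{V_1,\dots,V_m\}\cup\{(0,\dots,0)\}$. Define $\mu_h = \inf\{k \in \mathbb{R}_{>0} : k\Delta(h) \cap \mathbb{Z}_{>0}^n \neq \varnothing\}$, where $k\Delta(h)$ is the dilation of $\Delta(h)$ by $k$, and $\mu_h = \infty$ if no such $k$ exists. For the polynomial vector $f$, fix a basis $e_1,\dots,e_n$ of $\mathbb{F}_{q^n}$ over $\mathbb{F}_q$ and set $g(x_1,\dots,x_n) = f_1(x_1,\dots,x_n)e_1 + \cdots + f_n(x_1,\dots,x_n)e_n \in \mathbb{F}_{q^n}[x_1,\dots,x_n]$; then $\Delta(f) := \Delta(g)$ and $\mu_f := \mu_g$. (Equivalently, $\Delta(f)$ is the convex hull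 of the origin together with the exponent vectors of all monomials occurring with nonzero coefficient in some $f_i$.)
   Formalization: For n = 1 the polynomial f is additionally assumed nonconstant, since for n = 1 and constant f one has μ_f = ∞ and |V_f| = 1, so the stated bound would read 1 ≤ 0. *)

theory Defs
  imports "HOL-Analysis.Analysis" "HOL-Library.Poly_Mapping"
begin

text \<open>
  Polynomials in variables indexed by a finite type \<open>'n\<close>, as finitely supported coefficient
  functions on exponent vectors; addition and multiplication are those of \<open>\<Rightarrow>\<^sub>0\<close>.
\<close>

type_synonym ('n, 'a) mpoly = "('n \<Rightarrow>\<^sub>0 nat) \<Rightarrow>\<^sub>0 'a"

definition mpoly_eval :: "('n::finite, 'a::comm_semiring_1) mpoly \<Rightarrow> 'a ^ 'n \<Rightarrow> 'a" where
  "mpoly_eval h x =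
     (\<Sum>m\<in>Poly_Mapping.keys h. Poly_Mapping.lookup h m * (\<Prod>i\<in>UNIV. (x $ i) ^ Poly_Mapping.lookup m i))"

definition poly_vector_map :: "('n::finite, 'a::comm_semiring_1) mpoly ^ 'n \<Rightarrow> 'a ^ 'n \<Rightarrow> 'a ^ 'n" where
  "poly_vector_map f x = (\<chi> i. mpoly_eval (f $ i) x)"

definition value_set :: "('n::finite, 'a::comm_semiring_1) mpoly ^ 'n \<Rightarrow> ('a ^ 'n) set" where
  "value_set f = poly_vector_map f ` UNIV"

definition newton_polytope :: "('n::finite, 'a::zero) mpoly \<Rightarrow> (real ^ 'n) set" where
  "newton_polytope h =
     convex hull (insert 0 ((\<lambda>m. \<chi> i. real (Poly_Mapping.lookup m i)) ` Poly_Mapping.keys h))"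

text \<open>The infimum is taken in the extended reals, so it is \<open>\<infinity>\<close> when no dilation works.\<close>

definition newton_mu :: "('n::finite, 'a::zero) mpoly \<Rightarrow> ereal" where
  "newton_mu h =
     Inf (ereal ` {k. 0 < k \<and>
       (\<lambda>v. k *\<^sub>R v) ` newton_polytope h \<inter> {v. \<forall>i. v $ i \<in> \<int> \<and> 0 < v $ i} \<noteq> {}})"

definition field_embedding :: "('a::field \<Rightarrow> 'b::field) \<Rightarrow> bool" where
  "field_embedding \<iota> \<longleftrightarrow>
     \<iota> 1 = 1 \<and> (\<forall>x y. \<iota> (x + y) = \<iota> x + \<iota> y) \<and> (\<forall>x y. \<iota> (x * y) = \<iota> x * \<iota> y)"

definition field_extension_basis :: "('a::field \<Rightarrow> 'b::field) \<Rightarrow> ('n::finite \<Rightarrow> 'b) \<Rightarrow> bool" where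
  "field_extension_basis \<iota> e \<longleftrightarrow>
     inj e \<and> \<not> module.dependent (\<lambda>c y. \<iota> c * y) (e ` UNIV) \<and>
     module.span (\<lambda>c y. \<iota> c * y) (e ` UNIV) = UNIV"

text \<open>
  The polynomial \<open>g = f\<^sub>1 e\<^sub>1 + \<dots> + f\<^sub>n e\<^sub>n\<close> over the extension field; coefficients of \<open>f\<close> are
  transported along \<open>\<iota>\<close>, and \<open>single 0 c\<close> is the constant polynomial \<open>c\<close>.
\<close>

definition combined_poly ::
  "('a::field \<Rightarrow> 'b::field) \<Rightarrow> ('n::finite \<Rightarrow> 'b) \<Rightarrow> ('n, 'a) mpoly ^ 'n \<Rightarrow> ('n, 'b) mpoly" where
  "combined_poly \<iota> e f =
     (\<Sum>i\<in>UNIV. Poly_Mapping.map \<iota> (f $ i) * Poly_Mapping.single 0 (e i))"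

definition newton_mu_vector ::
  "('a::field \<Rightarrow> 'b::field) \<Rightarrow> ('n::finite \<Rightarrow> 'b) \<Rightarrow> ('n, 'a) mpoly ^ 'n \<Rightarrow> ereal" where
  "newton_mu_vector \<iota> e f = newton_mu (combined_poly \<iota> e f)"

text \<open>
  The support of \<open>g\<close>, hence the polytope and \<open>\<mu>\<close>, does not depend on the choice of the extension
  and the basis.
\<close>

lemma lookup_mult_single_0:
  fixes h :: "('n, 'b::comm_semiring_1) mpoly"
  shows "Poly_Mapping.lookup (h * Poly_Mapping.single 0 c) m = Poly_Mapping.lookup h m * c"
proof -
  have "Sum_any (\<lambda>r. Poly_Mapping.lookup (Poly_Mapping.single 0 c) r when m = l + r) = (c when m = l)" for l
  proof -
    have "(\<lambda>r. Poly_Mapping.lookup (Poly_Mapping.single 0 c) r when m = l + r) =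
            (\<lambda>r. (c when m = l) when r = 0)"
      by (auto simp: lookup_single when_def)
    then show ?thesis by (simp only: Sum_any_when_equal)
  qed
  then have "Poly_Mapping.lookup (h * Poly_Mapping.single 0 c) m =
               Sum_any (\<lambda>l. Poly_Mapping.lookup h l * (c when m = l))"
    by (simp add: lookup_mult)
  also have "(\<lambda>l. Poly_Mapping.lookup h l * (c when m = l)) = (\<lambda>l. (Poly_Mapping.lookup h m * c) when l = m)"
    by (auto simp: when_def)
  finally show ?thesis by (simp only: Sum_any_when_equal)
qed

lemma lookup_combined_poly:
  assumes "field_embedding \<iota>"
  shows "Poly_Mapping.lookup (combined_poly \<iota> e f) m =
           (\<Sum>i\<in>UNIV. \<iota> (Poly_Mapping.lookup (f $ i) m) * e i)"
proof -
  have "\<iota> (0 + 0) = \<iota> 0 + \<iota> 0"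
    using assms unfolding field_embedding_def by blast
  then have "\<iota> 0 = 0" by (metis add_cancel_right_right)
  then show ?thesis
    by (simp add: combined_poly_def lookup_sum lookup_mult_single_0 map.rep_eq when_def)
       (auto intro!: sum.cong)
qed

lemma keys_combined_poly:
  fixes e :: "'n::finite \<Rightarrow> 'b::field" and f :: "('n, 'a::field) mpoly ^ 'n"
  assumes emb: "field_embedding \<iota>" and basis: "field_extension_basis \<iota> e"
  shows "Poly_Mapping.keys (combined_poly \<iota> e f) = (\<Union>i. Poly_Mapping.keys (f $ i))"
proof -
  have hom: "\<iota> 1 = 1" "\<iota> (x + y) = \<iota> x + \<iota> y" "\<iota> (x * y) = \<iota> x * \<iota> y" for x y
    using emb unfolding field_embedding_def by auto
  interpret module "\<lambda>c y. \<iota> c * y"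
    by unfold_locales (auto simp: hom algebra_simps)
  have zero: "\<iota> 0 = 0"
    using hom(2)[of 0 0] by (metis add_cancel_right_right)
  have inj: "inj e" and indep: "independent (e ` UNIV)"
    using basis unfolding field_extension_basis_def by auto
  have "(\<Sum>i\<in>UNIV. \<iota> (c i) * e i) = 0 \<longleftrightarrow> (\<forall>i. c i = 0)" for c :: "'n \<Rightarrow> 'a"
  proof
    assume s: "(\<Sum>i\<in>UNIV. \<iota> (c i) * e i) = 0"
    have "(\<Sum>v\<in>e ` UNIV. \<iota> (c (inv e v)) * v) = 0"
      using s by (simp add: sum.reindex[OF inj] inj)
    then have "c (inv e v) = 0" if "v \<in> e ` UNIV" for v
      using independentD[OF indep, of "e ` UNIV" "\<lambda>v. c (inv e v)" v] that by simp
    then show "\<forall>i. c i = 0"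
      by (metis inj inv_f_f rangeI)
  qed (simp add: zero)
  then show ?thesis
    by (auto simp: in_keys_iff lookup_combined_poly[OF emb])
qed

text \<open>
  For \<open>n = 1\<close> and a constant polynomial, \<open>\<mu> = \<infinity>\<close> and the bound \<open>|V| \<le> q\<^sup>n - min {q, \<mu> (q - 1)}\<close> would
  read \<open>1 \<le> 0\<close>, so this case has to be excluded.
\<close>

lemma univariate_zero_polynomial_violates_bound:
  fixes f :: "(('n::finite, 'a::{field, finite}) mpoly) ^ 'n"
    and \<iota> :: "'a \<Rightarrow> 'b::{field, finite}"
    and e :: "'n \<Rightarrow> 'b"
  assumes "CARD('n) = 1" and f: "f = 0" and emb: "field_embedding \<iota>" and "field_extension_basis \<iota> e"
  shows "card (value_set f) < CARD('a) ^ CARD('n)"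
    and "\<not> ereal (real (card (value_set f))) \<le>
           ereal (real (CARD('a) ^ CARD('n))) - min (ereal (real CARD('a))) (newton_mu_vector \<iota> e f * ereal (real CARD('a) - 1))"
proof -
  have vs: "value_set f = {0}"
    by (auto simp: value_set_def poly_vector_map_def mpoly_eval_def f vec_eq_iff)
  have "card {0, 1::'a} \<le> CARD('a)" by (rule card_mono) auto
  then have q2: "CARD('a) \<ge> 2" by simp
  have "Poly_Mapping.keys (combined_poly \<iota> e f) = {}"
    using assms by (simp add: keys_combined_poly)
  then have "newton_polytope (combined_poly \<iota> e f) = {0}"
    by (simp add: newton_polytope_def)
  then have mu: "newton_mu_vector \<iota> e f = \<infinity>"
    by (simp add: newton_mu_vector_def newton_mu_def top_ereal_def)
  show "card (value_set f) < CARD('a) ^ CARD('n)" using vs q2 assms(1) by simp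
  show "\<not> ereal (real (card (value_set f))) \<le>
           ereal (real (CARD('a) ^ CARD('n))) - min (ereal (real CARD('a))) (newton_mu_vector \<iota> e f * ereal (real CARD('a) - 1))"
    using vs q2 assms(1) mu by simp
qed

end

theory Submission
  imports Defs "HOL-Computational_Algebra.Polynomial_FPS" "HOL-Computational_Algebra.Primes"
begin

text \<open>
  Let \<open>N = q\<^sup>n\<close> and \<open>M = min {q, \<mu> (q - 1)}\<close>. If the elementary symmetric functions of degree
  \<open>0 < k < M\<close> of the values \<open>g(x)\<close> vanish, then \<open>\<Prod>(T - g(x))\<close> and \<open>T\<^sup>N - T = \<Prod>(T - a)\<close> differ by a
  polynomial of degree at most \<open>N - M\<close>; it vanishes on the value set and is nonzero unless \<open>g\<close> is
  onto. To see that they vanish, lift the values to characteristic \<open>0\<close> by replacing coefficients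
  and arguments by multiplicative representatives. The power sums of degree \<open>k < M\<close> of the lifted
  values are divisible by \<open>q\<close>, because every monomial of \<open>g\<^sup>k\<close> with all exponents divisible by
  \<open>q - 1\<close> misses some variable. As \<open>q\<close> does not divide \<open>k < q\<close>, Newton's identities make the lifted
  elementary symmetric functions divisible by \<open>p\<close>. Instead of \<open>p\<close>-adic integers, the lift
  lives in the integral monoid ring of the multiplicative monoid of the extension field.
\<close>

section \<open>Finite fields\<close>

text \<open>Multiplication by a nonzero \<open>x\<close> permutes the nonzero elements, so their
  product absorbs x^(q-1); the extra factor \<open>x\<close> raises the exponent to q.\<close>

lemma power_CARD_finite_field:
  fixes x :: "'a :: {field, finite}"
  shows "x ^ CARD('a) = x"
proof (cases "x = 0")
  case False
  have "x * (\<Prod>y\<in>UNIV-{0}. x * y) = x * x ^ (CARD('a) - 1) * \<Prod>(UNIV-{0})"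
    by (simp add: prod.distrib mult_ac)
  also have "x * x ^ (CARD('a) - 1) = x ^ Suc (CARD('a) - 1)"
    by (rule power_Suc[symmetric])
  also have "Suc (CARD('a) - 1) = CARD('a)"
    using finite_UNIV_card_ge_0[where ?'a = 'a] by simp
  also have "(\<Prod>y\<in>UNIV-{0}. x * y) = (\<Prod>y\<in>UNIV-{0}. y)"
    by (rule prod.reindex_bij_witness[of _ "\<lambda>y. y / x" "\<lambda>y. x * y"]) (use False in auto)
  finally show ?thesis by simp
qed (use finite_UNIV_card_ge_0[where ?'a = 'a] in auto)

lemma CARD_field_ge_2: "CARD('a :: {field, finite}) \<ge> 2"
proof -
  have "card {0, 1::'a} \<le> CARD('a)" by (rule card_mono) auto
  then show ?thesis by simp
qed

lemma power_CARD_minus_1_finite_field: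
  fixes x :: "'a :: {field, finite}"
  assumes "x \<noteq> 0"
  shows "x ^ (CARD('a) - 1) = 1"
proof -
  have "CARD('a) = Suc (CARD('a) - 1)" using CARD_field_ge_2[where 'a = 'a] by simp
  then have "x * x ^ (CARD('a) - 1) = x * 1"
    using power_CARD_finite_field[of x] by (metis mult.right_neutral power_Suc)
  with assms show ?thesis by simp
qed

text \<open>Otherwise the remainder b of \<open>r\<close> modulo q - 1 satisfies 0 < b < q - 1,
  while T^b - 1 has all q - 1 nonzero elements as roots.\<close>

lemma dvd_exponent_finite_field:
  assumes "\<And>t :: 'a :: {field, finite}. t \<noteq> 0 \<Longrightarrow> t ^ r = 1"
  shows "(CARD('a) - 1) dvd r"
proof (rule ccontr)
  define b where "b = r mod (CARD('a) - 1)"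
  have q: "CARD('a) \<ge> 2" by (rule CARD_field_ge_2)
  assume "\<not> (CARD('a) - 1) dvd r"
  then have b: "b > 0" unfolding b_def by (simp add: mod_greater_zero_iff_not_dvd)
  have b': "b < CARD('a) - 1" unfolding b_def using q by simp
  have pow: "t ^ b = 1" if "t \<noteq> 0" for t :: 'a
  proof -
    have "1 = t ^ ((CARD('a) - 1) * (r div (CARD('a) - 1)) + b)"
      using assms[OF that] by (simp add: b_def)
    then show ?thesis
      using power_CARD_minus_1_finite_field[OF that] by (simp add: power_add power_mult)
  qed
  define p :: "'a poly" where "p = monom 1 b - 1"
  have "coeff p b = 1" using b by (simp add: p_def)
  then have "p \<noteq> 0" by auto
  then have "card {x. poly p x = 0} \<le> degree p" by (rule card_poly_roots_bound)
  also have "\<dots> \<le> b"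
    unfolding p_def by (intro degree_diff_le) (auto intro: degree_monom_le)
  finally have "card {x. poly p x = 0} \<le> b" .
  moreover have "card (UNIV - {0 :: 'a}) \<le> card {x. poly p x = 0}"
    by (intro card_mono) (auto simp: p_def poly_monom pow)
  ultimately show False using b' by (simp add: card_Diff_singleton)
qed

lemma prime_CHAR_finite_field: "prime CHAR('a :: {field, finite})"
  by (intro prime_CHAR_semidom finite_imp_CHAR_pos) auto

text \<open>A maximal additive subgroup of \<open>p\<close>-power order is everything: otherwise an outside element
  \<open>a\<close> would enlarge it by the factor \<open>p\<close>.\<close>
lemma CARD_finite_field_eq_power: "\<exists>s. CARD('a :: {field, finite}) = CHAR('a) ^ s"
proof -
  define p where "p = CHAR('a)"
  have pr: "prime p" unfolding p_def by (rule prime_CHAR_finite_field)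
  then have p0: "p > 0" by (simp add: prime_gt_0_nat)
  define S where "S = {H :: 'a set. 0 \<in> H \<and> (\<forall>x\<in>H. \<forall>y\<in>H. x - y \<in> H) \<and> (\<exists>s. card H = p ^ s)}"
  have "{0} \<in> S" by (auto simp: S_def intro: exI[of _ 0])
  then have "S \<noteq> {}" by blast
  then obtain H where H: "H \<in> S" and max: "\<And>K. K \<in> S \<Longrightarrow> card K \<le> card H"
    using finite_has_maximal[of "card ` S"] by (auto simp: image_iff) (metis linorder_le_cases)
  then obtain s where z: "0 \<in> H" and sub: "\<And>x y. x \<in> H \<Longrightarrow> y \<in> H \<Longrightarrow> x - y \<in> H"
    and card: "card H = p ^ s" by (auto simp: S_def)
  have neg: "- x \<in> H" if "x \<in> H" for x using sub[OF z that] by simp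
  have add: "x + y \<in> H" if "x \<in> H" "y \<in> H" for x y using sub[OF that(1) neg[OF that(2)]] by simp
  have mul: "of_nat k * x \<in> H" if "x \<in> H" for k x
    by (induction k) (auto simp: z algebra_simps intro: add that)
  have mulz: "of_int k * x \<in> H" if "x \<in> H" for k x
    using mul[OF that] neg by (cases k) (auto simp: algebra_simps simp del: of_nat_Suc)
  have "H = UNIV"
  proof (rule ccontr)
    assume "H \<noteq> UNIV"
    then obtain a where a: "a \<notin> H" by blast
    define K where "K = (\<lambda>(i, h). of_nat i * a + h) ` ({..<p} \<times> H)"
    \<comment> \<open>If k were prime to p, Bezout and p a = 0 would put a itself into
      \<open>H\<close>. Hence the p cosets i a + H that make up \<open>K\<close> are
      disjoint.\<close>
    have cop: "int p dvd k" if "of_int k * a \<in> H" for k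
    proof (rule ccontr)
      assume "\<not> int p dvd k"
      with pr have "coprime k (int p)"
        by (metis coprime_commute prime_imp_coprime prime_nat_int_transfer)
      then obtain u v where "u * k + v * int p = 1"
        by (metis bezout_int coprime_imp_gcd_eq_1)
      then have "of_int (u * k + v * int p) * a = a" by simp
      moreover have "(of_nat p :: 'a) = 0" by (simp add: p_def)
      ultimately have "a = of_int u * (of_int k * a)" by simp
      with mulz[OF that, of u] a show False by simp
    qed
    have inj: "inj_on (\<lambda>(i, h). of_nat i * a + h) ({..<p} \<times> H)"
    proof (rule inj_onI, clarsimp)
      fix i h j h'
      assume *: "i < p" "h \<in> H" "j < p" "h' \<in> H" "of_nat i * a + h = of_nat j * a + h'"
      then have "of_int (int i - int j) * a = h' - h" by (simp add: algebra_simps)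
      with sub[OF *(4,2)] have "int p dvd int i - int j" using cop by metis
      moreover have "\<bar>int i - int j\<bar> < int p" using * by auto
      ultimately have "i = j" using dvd_imp_le_int[of "int i - int j" "int p"] by fastforce
      with * show "i = j \<and> h = h'" by simp
    qed
    have memK: "of_int k * a + h \<in> K" if "h \<in> H" for k h
    proof -
      have "of_int k * a = of_int (k mod int p + k div int p * int p) * (a :: 'a)" by simp
      also have "\<dots> = of_int (k mod int p) * a"
        unfolding of_int_add of_int_mult by (simp add: p_def)
      also have "\<dots> = of_nat (nat (k mod int p)) * a"
        using p0 by (simp add: of_nat_nat)
      finally show ?thesis
        unfolding K_def using that p0
        by (intro image_eqI[of _ _ "(nat (k mod int p), h)"]) (auto simp: nat_less_iff)
    qed
    have "K \<in> S"
    proof -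
      have "x - y \<in> K" if xy: "x \<in> K" "y \<in> K" for x y
      proof -
        obtain i h j h' where "x = of_nat i * a + h" "y = of_nat j * a + h'" "h \<in> H" "h' \<in> H"
          using xy unfolding K_def by auto
        then show ?thesis
          using memK[OF sub, of h h' "int i - int j"] by (simp add: algebra_simps)
      qed
      moreover have "0 \<in> K" using memK[OF z, of 0] by simp
      moreover have "card K = p ^ Suc s"
        unfolding K_def by (simp add: card_image[OF inj] card)
      ultimately show ?thesis unfolding S_def by blast
    qed
    from max[OF this] have "p * p ^ s \<le> p ^ s"
      unfolding K_def by (simp add: card_image[OF inj] card)
    then show False using prime_gt_1_nat[OF pr] by simp
  qed
  with card show ?thesis by (auto simp: p_def)
qed

text \<open>If \<open>p\<close> did not divide \<open>c\<close>, all of p^s would divide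
  \<open>k\<close>. So division by \<open>k\<close> costs fewer than \<open>s\<close> factors of
  \<open>p\<close>, even when \<open>p\<close> divides \<open>k\<close>.\<close>

lemma prime_dvd_of_mult_eq_prime_power_mult:
  fixes c y :: int
  assumes p: "prime p" and k: "0 < k" "k < p ^ s" and eq: "int k * c = int (p ^ s) * y"
  shows "int p dvd c"
proof (rule ccontr)
  assume nd: "\<not> int p dvd c"
  with p have "coprime (int p) c"
    by (metis prime_imp_coprime prime_nat_int_transfer)
  then have "coprime (int (p ^ s)) c" by simp
  moreover have "int (p ^ s) dvd int k * c" using eq by simp
  ultimately have "int (p ^ s) dvd int k" by (metis coprime_dvd_mult_left_iff)
  then have "p ^ s dvd k" using int_dvd_int_iff by blast
  then show False using k by (auto dest: dvd_imp_le)
qed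

section \<open>Elementary symmetric functions\<close>

text \<open>Compare coefficients of X^k in E' = - E * (sum of y/(1 - y X)), the logarithmic
  derivative of E = prod (1 - y X). The coefficients of E already carry the signs of the elementary
  symmetric functions.\<close>

lemma newton_identity:
  fixes y :: "'i \<Rightarrow> 'c :: comm_ring_1"
  assumes "finite B"
  shows "of_nat (Suc k) * coeff (\<Prod>v\<in>B. [:1, - y v:]) (Suc k) =
           - (\<Sum>i\<le>k. coeff (\<Prod>v\<in>B. [:1, - y v:]) i * (\<Sum>v\<in>B. y v ^ Suc (k - i)))"
proof -
  \<comment> \<open>The geometric series y/(1 - y X); \<open>lG\<close> characterises it without
    division, as the ring may have zero divisors.\<close>
  define G where "G v = Abs_fps (\<lambda>j. y v ^ Suc j)" for v
  define l where "l v = 1 - fps_const (y v) * fps_X" for v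
  have lG: "l v * G v = fps_const (y v)" for v
    by (rule fps_ext) (auto simp: l_def G_def algebra_simps mult.assoc fps_X_mult_nth
        simp flip: power_Suc split: nat.split)
  have "fps_deriv (\<Prod>v\<in>B. l v) = - ((\<Prod>v\<in>B. l v) * (\<Sum>v\<in>B. G v))"
    using assms
  proof (induction B)
    case (insert x B)
    have "fps_deriv (\<Prod>v\<in>insert x B. l v) =
            fps_deriv (l x) * (\<Prod>v\<in>B. l v) + l x * fps_deriv (\<Prod>v\<in>B. l v)"
      using insert by (simp add: algebra_simps)
    also have "fps_deriv (l x) = - (l x * G x)" by (simp add: lG) (simp add: l_def)
    also have "- (l x * G x) * (\<Prod>v\<in>B. l v) + l x * fps_deriv (\<Prod>v\<in>B. l v) =
                 - ((\<Prod>v\<in>insert x B. l v) * (\<Sum>v\<in>insert x B. G v))"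
      using insert by (simp add: algebra_simps)
    finally show ?case .
  qed auto
  moreover have "(\<Prod>v\<in>B. l v) = fps_of_poly (\<Prod>v\<in>B. [:1, - y v:])"
    by (simp add: fps_of_poly_prod l_def fps_of_poly_pCons flip: fps_const_neg)
  ultimately have "fps_nth (fps_deriv (fps_of_poly (\<Prod>v\<in>B. [:1, - y v:]))) k =
      fps_nth (- (fps_of_poly (\<Prod>v\<in>B. [:1, - y v:]) * (\<Sum>v\<in>B. G v))) k"
    by simp
  then show ?thesis
    by (simp add: fps_mult_nth fps_sum_nth G_def atMost_atLeast0)
qed

text \<open>The polynomial \<open>\<Prod>(T - \<gamma> v) - (T\<^sup>N - T)\<close> vanishes on the image of \<open>\<gamma>\<close>, but not outside it,
  and the hypothesis on the elementary symmetric functions bounds its degree.\<close>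
lemma card_image_le_of_coeffs_zero:
  fixes \<gamma> :: "'i \<Rightarrow> 'b :: {field, finite}" and M :: real
  assumes I: "finite I" "card I = CARD('b)"
    and M: "M \<le> real CARD('b) - 1"
    and zero: "\<And>k. 0 < k \<Longrightarrow> real k < M \<Longrightarrow> coeff (\<Prod>v\<in>I. [:1, - \<gamma> v:]) k = 0"
    and proper: "\<gamma> ` I \<noteq> UNIV"
  shows "real (card (\<gamma> ` I)) \<le> real CARD('b) - M"
proof -
  define N where "N = CARD('b)"
  have N: "N \<ge> 2" unfolding N_def by (rule CARD_field_ge_2)
  define P where "P = (\<Prod>v\<in>I. [:- \<gamma> v, 1:])"
  define Q where "Q = P - (monom 1 N - monom 1 1)"
  have degP: "degree P = N"
    unfolding P_def N_def using I by (subst degree_prod_eq_sum_degree) auto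
  have refl: "reflect_poly P = (\<Prod>v\<in>I. [:1, - \<gamma> v:])"
    unfolding P_def reflect_poly_prod by (intro prod.cong) (auto simp: reflect_poly_def cCons_def)
  have cP: "coeff P (N - k) = 0" if "k \<le> N" "0 < k" "real k < M" for k
    using zero[of k] that by (simp flip: refl add: coeff_reflect_poly degP)
  have leadP: "coeff P N = 1"
  proof -
    have "lead_coeff P = 1" unfolding P_def lead_coeff_prod by simp
    then show ?thesis by (simp add: degP)
  qed
  have deg: "real (degree Q) \<le> real N - M" if "Q \<noteq> 0"
  proof (rule ccontr)
    assume *: "\<not> ?thesis"
    define d where "d = degree Q"
    \<comment> \<open>The bound on \<open>M\<close> keeps d above 1, so the term T of T^N - T does
      not disturb the coefficient in degree d.\<close>
    have d1: "d > 1" using * M by (simp add: d_def N_def)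
    have "d \<le> N"
    proof -
      have "degree Q \<le> N" unfolding Q_def using degP N
        by (intro degree_diff_le) (auto intro: degree_monom_le simp: degree_monom_eq)
      then show ?thesis by (simp add: d_def)
    qed
    have "coeff Q d = 0"
    proof (cases "d = N")
      case True
      then show ?thesis using leadP N by (simp add: Q_def)
    next
      case False
      then have "coeff P (N - (N - d)) = 0"
        using * \<open>d \<le> N\<close> by (intro cP) (auto simp: d_def of_nat_diff)
      then show ?thesis using False d1 \<open>d \<le> N\<close> by (simp add: Q_def)
    qed
    then show False using that by (simp add: d_def)
  qed
  obtain a where a: "a \<notin> \<gamma> ` I" using proper by blast
  \<comment> \<open>T^N - T is zero at every point of the field, so \<open>Q\<close> and
    \<open>P\<close> agree as functions.\<close>
  have eval: "poly Q x = (\<Prod>v\<in>I. x - \<gamma> v)" for x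
    by (simp add: Q_def P_def poly_prod poly_monom N_def power_CARD_finite_field)
  have "poly Q a \<noteq> 0" using a I by (auto simp: eval)
  then have Q: "Q \<noteq> 0" by auto
  have "card (\<gamma> ` I) \<le> card {x. poly Q x = 0}"
    using I by (intro card_mono) (auto simp: eval)
  also have "\<dots> \<le> degree Q" by (rule card_poly_roots_bound[OF Q])
  finally show ?thesis using deg[OF Q] by (simp add: N_def)
qed

section \<open>The integral monoid ring of the multiplicative monoid\<close>

text \<open>The convolution product of \<open>\<Rightarrow>\<^sub>0\<close> expects an additively
  written monoid, so the multiplicative monoid is wrapped and renamed.\<close>

datatype 'b multiplicative = Mul (unMul: 'b)

instantiation multiplicative :: (comm_monoid_mult) comm_monoid_add
begin
definition "0 = Mul 1"
definition "x + y = Mul (unMul x * unMul y)"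
instance by standard (auto simp: zero_multiplicative_def plus_multiplicative_def mult_ac)
end

type_synonym 'b monoid_ring = "'b multiplicative \<Rightarrow>\<^sub>0 int"

text \<open>The value at \<open>0\<close> is chosen as for Teichmueller representatives.\<close>
definition teichmueller :: "'b::field \<Rightarrow> 'b monoid_ring" where
  "teichmueller a = (if a = 0 then 0 else Poly_Mapping.single (Mul a) 1)"

text \<open>The ring homomorphism that extends \<open>Mul x\<close> to x linearly, in place of
  reduction of p-adic integers modulo p. It also kills the basis element of \<open>Mul 0\<close>,
  which is not zero in the monoid ring.\<close>

definition reduction :: "'b::{field, finite} monoid_ring \<Rightarrow> 'b" where
  "reduction c = (\<Sum>x\<in>UNIV. of_int (Poly_Mapping.lookup c (Mul x)) * x)"

lemma teichmueller_0 [simp]: "teichmueller 0 = 0"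
  by (simp add: teichmueller_def)

lemma teichmueller_1 [simp]: "teichmueller 1 = 1"
  by (simp add: teichmueller_def flip: zero_multiplicative_def)

lemma teichmueller_mult: "teichmueller (a * b) = teichmueller a * teichmueller b"
  by (simp add: teichmueller_def mult_single plus_multiplicative_def)

lemma teichmueller_power: "teichmueller (a ^ k) = teichmueller a ^ k"
  by (induction k) (simp_all add: teichmueller_mult)

lemma reduction_0 [simp]: "reduction 0 = 0"
  by (simp add: reduction_def)

lemma reduction_add: "reduction (c + d) = reduction c + reduction d"
  by (simp add: reduction_def lookup_add algebra_simps sum.distrib)

lemma reduction_diff: "reduction (c - d) = reduction c - reduction d"
  by (simp add: reduction_def lookup_minus algebra_simps sum_subtractf)

lemma reduction_sum: "reduction (sum c A) = (\<Sum>i\<in>A. reduction (c i))"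
  by (induction A rule: infinite_finite_induct) (simp_all add: reduction_add)

lemma reduction_single: "reduction (Poly_Mapping.single (Mul a) n) = of_int n * a"
proof -
  have "reduction (Poly_Mapping.single (Mul a) n) = (\<Sum>x\<in>UNIV. if x = a then of_int n * x else 0)"
    unfolding reduction_def by (intro sum.cong) (auto simp: lookup_single when_def)
  then show ?thesis by simp
qed

lemma reduction_teichmueller [simp]: "reduction (teichmueller a) = a"
  by (simp add: teichmueller_def reduction_single)

lemma reduction_1 [simp]: "reduction 1 = 1"
  using reduction_teichmueller[of 1] by simp

lemma monoid_ring_expansion:
  fixes c :: "'b::{field, finite} monoid_ring"
  shows "c = (\<Sum>x\<in>UNIV. Poly_Mapping.single (Mul x) (Poly_Mapping.lookup c (Mul x)))"
proof (rule poly_mapping_eqI)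
  fix m :: "'b multiplicative"
  obtain y where m: "m = Mul y" by (cases m)
  have "Poly_Mapping.lookup (\<Sum>x\<in>UNIV. Poly_Mapping.single (Mul x) (Poly_Mapping.lookup c (Mul x))) m =
     (\<Sum>x\<in>UNIV. if x = y then Poly_Mapping.lookup c (Mul x) else 0)"
    unfolding lookup_sum by (intro sum.cong) (auto simp: lookup_single when_def m)
  then show "Poly_Mapping.lookup c m =
      Poly_Mapping.lookup (\<Sum>x\<in>UNIV. Poly_Mapping.single (Mul x) (Poly_Mapping.lookup c (Mul x))) m"
    by (simp add: m)
qed

lemma reduction_mult: "reduction (c * d) = reduction c * reduction d"
proof -
  let ?s = "\<lambda>c x. Poly_Mapping.single (Mul x) (Poly_Mapping.lookup c (Mul x))"
  have "reduction (c * d) = reduction ((\<Sum>x\<in>UNIV. ?s c x) * (\<Sum>y\<in>UNIV. ?s d y))"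
    by (simp flip: monoid_ring_expansion)
  also have "\<dots> = reduction (\<Sum>x\<in>UNIV. \<Sum>y\<in>UNIV. ?s c x * ?s d y)"
    by (simp add: sum_product)
  also have "\<dots> = (\<Sum>x\<in>UNIV. \<Sum>y\<in>UNIV. reduction (?s c x * ?s d y))"
    by (simp add: reduction_sum)
  also have "\<dots> = reduction c * reduction d"
    unfolding mult_single plus_multiplicative_def multiplicative.sel reduction_single
    by (simp add: reduction_def sum_product mult_ac)
  finally show ?thesis .
qed

lemma reduction_prod: "reduction (prod c A) = (\<Prod>i\<in>A. reduction (c i))"
  by (induction A rule: infinite_finite_induct) (simp_all add: reduction_mult)

lemma reduction_power: "reduction (c ^ k) = reduction c ^ k"
  by (induction k) (simp_all add: reduction_mult)

lemma reduction_coeff_prod: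
  assumes "finite B"
  shows "reduction (coeff (\<Prod>v\<in>B. [:1, - y v:]) k) = coeff (\<Prod>v\<in>B. [:1, - reduction (y v):]) k"
  using assms
proof (induction B arbitrary: k)
  case empty
  show ?case by (simp add: coeff_1)
next
  case (insert x B)
  then show ?case
    by (cases k) (simp_all add: coeff_pCons reduction_diff reduction_mult)
qed

text \<open>The monoid ring is free over the integers, so divisibility by the characteristic follows
  for each coefficient of \<open>c\<close> separately.\<close>

lemma reduction_eq_0_of_torsion:
  fixes c :: "'b::{field, finite} monoid_ring"
  assumes q: "q = CHAR('b) ^ s" and k: "0 < k" "k < q" and eq: "of_nat k * c = of_nat q * y"
  shows "reduction c = 0"
proof -
  have "(of_int (Poly_Mapping.lookup c m) :: 'b) = 0" for m
  proof -
    have "Poly_Mapping.lookup (of_nat k * c) m = Poly_Mapping.lookup (of_nat q * y) m"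
      using eq by simp
    moreover have nat: "Poly_Mapping.lookup (of_nat r * z) m = int r * Poly_Mapping.lookup z m"
      for r and z :: "'b monoid_ring"
      by (induction r) (simp_all add: algebra_simps lookup_add)
    ultimately have "int k * Poly_Mapping.lookup c m = int (CHAR('b) ^ s) * Poly_Mapping.lookup y m"
      by (simp only: nat) (simp add: q)
    then have "int CHAR('b) dvd Poly_Mapping.lookup c m"
      using k prime_CHAR_finite_field[where 'a = 'b]
      by (intro prime_dvd_of_mult_eq_prime_power_mult[of "CHAR('b)" k s]) (auto simp: q)
    then show ?thesis by (auto elim!: dvdE)
  qed
  then show ?thesis by (simp add: reduction_def)
qed


section \<open>Power sums and the Newton polytope\<close>

lemma sum_vec_prod:
  fixes h :: "'n::finite \<Rightarrow> 'a::finite \<Rightarrow> 'c::comm_semiring_1"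
  shows "(\<Sum>x\<in>(UNIV :: ('a ^ 'n) set). \<Prod>i\<in>UNIV. h i (x $ i)) = (\<Prod>i\<in>UNIV. \<Sum>t\<in>UNIV. h i t)"
proof -
  have "(\<Prod>i\<in>UNIV. \<Sum>t\<in>UNIV. h i t) = (\<Sum>g\<in>UNIV. \<Prod>i\<in>UNIV. h i (g i))"
    by (subst prod_sum_PiE) (simp_all add: PiE_UNIV_domain)
  also have "\<dots> = (\<Sum>x\<in>UNIV. \<Prod>i\<in>UNIV. h i (x $ i))"
    by (rule sum.reindex_bij_witness[of _ vec_nth vec_lambda]) auto
  finally show ?thesis ..
qed

section \<open>Arithmetic of field embeddings\<close>

lemma field_embedding_0: "field_embedding \<iota> \<Longrightarrow> \<iota> 0 = 0"
  unfolding field_embedding_def by (metis add_cancel_right_right)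

lemma field_embedding_diff: "field_embedding \<iota> \<Longrightarrow> \<iota> (x - y) = \<iota> x - \<iota> y"
  unfolding field_embedding_def by (metis diff_add_cancel add_diff_cancel_right')

lemma field_embedding_eq_0_iff: "field_embedding \<iota> \<Longrightarrow> \<iota> x = 0 \<longleftrightarrow> x = 0"
  using field_embedding_0[of \<iota>] unfolding field_embedding_def
  by (metis field_class.field_inverse mult_zero_right zero_neq_one mult.commute)

lemma field_embedding_eq_iff: "field_embedding \<iota> \<Longrightarrow> \<iota> x = \<iota> y \<longleftrightarrow> x = y"
  using field_embedding_eq_0_iff[of \<iota> "x - y"] by (simp add: field_embedding_diff)

lemma field_embedding_power: "field_embedding \<iota> \<Longrightarrow> \<iota> (x ^ k) = \<iota> x ^ k"
  unfolding field_embedding_def by (induction k) simp_all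

lemma field_embedding_prod: "field_embedding \<iota> \<Longrightarrow> \<iota> (prod h A) = (\<Prod>i\<in>A. \<iota> (h i))"
  unfolding field_embedding_def by (induction A rule: infinite_finite_induct) simp_all

lemma field_embedding_sum: "field_embedding \<iota> \<Longrightarrow> \<iota> (sum h A) = (\<Sum>i\<in>A. \<iota> (h i))"
  using field_embedding_0[of \<iota>] unfolding field_embedding_def
  by (induction A rule: infinite_finite_induct) simp_all

text \<open>The monoid ring has zero divisors, so a power sum over a nontrivial character need not vanish.
  It does after multiplication with this element, whose reduction is nonzero.\<close>
definition annihilator :: "('a::{field, finite} \<Rightarrow> 'b::{field, finite}) \<Rightarrow> 'b monoid_ring" where
  "annihilator \<iota> = (\<Prod>c\<in>UNIV - {0, 1}. 1 - teichmueller (\<iota> c))"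

lemma reduction_annihilator: "field_embedding \<iota> \<Longrightarrow> reduction (annihilator \<iota>) \<noteq> 0"
  using field_embedding_eq_iff[of \<iota> 1]
  by (auto simp: annihilator_def reduction_prod reduction_diff field_embedding_def)

text \<open>Substituting t u for u multiplies the power sum by the lift of t^r. So 1 minus this lift
  kills the sum, and it is a factor of \<open>annihilator\<close> because t^r is neither 0 nor
  1.\<close>

lemma annihilator_power_sum:
  fixes \<iota> :: "'a::{field, finite} \<Rightarrow> 'b::{field, finite}" and t :: 'a
  assumes emb: "field_embedding \<iota>" and t: "t \<noteq> 0" "t ^ r \<noteq> 1"
  shows "annihilator \<iota> * (\<Sum>u\<in>UNIV. teichmueller (\<iota> u) ^ r) = 0"
proof -
  have mult: "\<iota> (x * y) = \<iota> x * \<iota> y" for x y using emb by (simp add: field_embedding_def)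
  have "teichmueller (\<iota> (t ^ r)) * (\<Sum>u\<in>UNIV. teichmueller (\<iota> u) ^ r) =
          (\<Sum>u\<in>UNIV. teichmueller (\<iota> (t * u)) ^ r)"
    by (simp add: sum_distrib_left mult teichmueller_mult power_mult_distrib
        field_embedding_power[OF emb] teichmueller_power)
  also have "\<dots> = (\<Sum>u\<in>UNIV. teichmueller (\<iota> u) ^ r)"
    by (rule sum.reindex_bij_witness[of _ "\<lambda>u. u / t" "\<lambda>u. t * u"]) (use t in auto)
  finally have "(1 - teichmueller (\<iota> (t ^ r))) * (\<Sum>u\<in>UNIV. teichmueller (\<iota> u) ^ r) = 0"
    by (simp add: algebra_simps)
  moreover have "1 - teichmueller (\<iota> (t ^ r)) dvd annihilator \<iota>"
    unfolding annihilator_def using t by (intro dvd_prodI) auto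
  ultimately show ?thesis by (auto elim!: dvdE simp: mult_ac)
qed

text \<open>For \<open>r = 0\<close> all q summands are 1, that of u = 0 included since 0^0 = 1; in
  the other case the product is 0.\<close>

lemma CARD_dvd_annihilator_power_sum:
  fixes \<iota> :: "'a::{field, finite} \<Rightarrow> 'b::{field, finite}"
  assumes emb: "field_embedding \<iota>" and r: "r = 0 \<or> \<not> CARD('a) - 1 dvd r"
  shows "of_nat CARD('a) dvd annihilator \<iota> * (\<Sum>u\<in>UNIV. teichmueller (\<iota> u) ^ r)"
proof (cases "r = 0")
  case False
  with r obtain t :: 'a where "t \<noteq> 0" "t ^ r \<noteq> 1"
    using dvd_exponent_finite_field by blast
  with annihilator_power_sum[OF emb] show ?thesis by simp
qed simp

text \<open>The average of the \<open>k\<close> exponent vectors lies in the polytope, and its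
  dilation by k/Q is the positive lattice point \<open>w\<close>.\<close>

lemma newton_mu_le:
  fixes g :: "('n::finite, 'b::zero) mpoly"
  assumes k: "k > 0" and Q: "Q > 0" and \<phi>: "\<And>j. j < k \<Longrightarrow> \<phi> j \<in> Poly_Mapping.keys g"
    and w: "\<And>i. w i > 0" "\<And>i. (\<Sum>j<k. Poly_Mapping.lookup (\<phi> j) i) = Q * w i"
  shows "newton_mu g * ereal (real Q) \<le> ereal (real k)"
proof -
  define V where "V m = (\<chi> i. real (Poly_Mapping.lookup m i))" for m :: "'n \<Rightarrow>\<^sub>0 nat"
  define v where "v = (\<Sum>j<k. (1 / real k) *\<^sub>R V (\<phi> j))"
  have "v \<in> newton_polytope g"
    unfolding v_def newton_polytope_def
  proof (intro convex_sum)
    show "V (\<phi> j) \<in> convex hull (insert 0 ((\<lambda>m. \<chi> i. real (Poly_Mapping.lookup m i)) ` Poly_Mapping.keys g))"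
      if "j \<in> {..<k}" for j
      using \<phi>[of j] that by (intro hull_inc) (auto simp: V_def)
  qed (use k in auto)
  moreover have "((real k / real Q) *\<^sub>R v) $ i = real (w i)" for i
  proof -
    have "((real k / real Q) *\<^sub>R v) $ i = (\<Sum>j<k. real (Poly_Mapping.lookup (\<phi> j) i)) / real Q"
      using k by (simp add: v_def V_def flip: sum_distrib_left sum_divide_distrib)
    also have "\<dots> = real (\<Sum>j<k. Poly_Mapping.lookup (\<phi> j) i) / real Q" by simp
    finally show ?thesis using Q unfolding w(2) by simp
  qed
  ultimately have "(real k / real Q) *\<^sub>R v \<in>
      (\<lambda>v. (real k / real Q) *\<^sub>R v) ` newton_polytope g \<inter> {v. \<forall>i. v $ i \<in> \<int> \<and> 0 < v $ i}"
    using w(1) by (auto simp del: vector_scaleR_component)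
  then have "newton_mu g \<le> ereal (real k / real Q)"
    unfolding newton_mu_def using k Q by (intro Inf_lower) (auto intro!: imageI)
  then have "newton_mu g * ereal (real Q) \<le> ereal (real k / real Q) * ereal (real Q)"
    by (intro ereal_mult_right_mono) auto
  then show ?thesis using Q by simp
qed

lemma newton_mu_nonneg: "0 \<le> newton_mu g"
  unfolding newton_mu_def by (auto intro!: Inf_greatest)

text \<open>This is not \<open>teichmueller\<close> of the value: being polynomial in the lifted
  arguments, it has powers that expand into monomials.\<close>

definition teichmueller_eval ::
  "('a::field \<Rightarrow> 'b::{field, finite}) \<Rightarrow> ('n::finite, 'b) mpoly \<Rightarrow> 'a ^ 'n \<Rightarrow> 'b monoid_ring" where
  "teichmueller_eval \<iota> g x =
     (\<Sum>m\<in>Poly_Mapping.keys g. teichmueller (Poly_Mapping.lookup g m) *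
        (\<Prod>i\<in>UNIV. teichmueller (\<iota> (x $ i)) ^ Poly_Mapping.lookup m i))"

lemma reduction_teichmueller_eval:
  "reduction (teichmueller_eval \<iota> g x) = mpoly_eval g (\<chi> i. \<iota> (x $ i))"
  by (simp add: teichmueller_eval_def mpoly_eval_def reduction_sum reduction_mult reduction_prod
      reduction_power)

text \<open>Only monomials of \<open>g\<^sup>k\<close> with all exponents positive multiples of \<open>q - 1\<close> could contribute a
  sum that is not divisible by \<open>q\<close>, and these give lattice points in \<open>k / (q - 1) \<Delta>(g)\<close>.\<close>
lemma CARD_dvd_annihilator_power_sum_eval:
  fixes \<iota> :: "'a::{field, finite} \<Rightarrow> 'b::{field, finite}" and g :: "('n::finite, 'b) mpoly"
  assumes emb: "field_embedding \<iota>" and k: "k > 0"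
    and mu: "ereal (real k) < newton_mu g * ereal (real (CARD('a) - 1))"
  shows "of_nat CARD('a) dvd annihilator \<iota> * (\<Sum>x\<in>UNIV. teichmueller_eval \<iota> g x ^ k)"
proof -
  \<comment> \<open>Each \<phi> chooses a monomial from every one of the \<open>k\<close> factors;
    \<open>a \<phi>\<close> and \<open>u \<phi>\<close> are the coefficient and the exponent vector
    of the resulting product.\<close>
  define \<Phi> where "\<Phi> = PiE {..<k} (\<lambda>_. Poly_Mapping.keys g)"
  define a where "a \<phi> = (\<Prod>j<k. teichmueller (Poly_Mapping.lookup g (\<phi> j)))" for \<phi>
  define u where "u \<phi> i = (\<Sum>j<k. Poly_Mapping.lookup (\<phi> j) i)" for \<phi> :: "nat \<Rightarrow> 'n \<Rightarrow>\<^sub>0 nat" and i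
  have "teichmueller_eval \<iota> g x ^ k = (\<Sum>\<phi>\<in>\<Phi>. a \<phi> * (\<Prod>i\<in>UNIV. teichmueller (\<iota> (x $ i)) ^ u \<phi> i))" for x
  proof -
    have "teichmueller_eval \<iota> g x ^ k = (\<Prod>j<k. teichmueller_eval \<iota> g x)" by simp
    also have "\<dots> = (\<Sum>\<phi>\<in>\<Phi>. \<Prod>j<k. teichmueller (Poly_Mapping.lookup g (\<phi> j)) *
        (\<Prod>i\<in>UNIV. teichmueller (\<iota> (x $ i)) ^ Poly_Mapping.lookup (\<phi> j) i))"
      unfolding teichmueller_eval_def \<Phi>_def by (rule prod_sum_PiE) auto
    also have "\<dots> = (\<Sum>\<phi>\<in>\<Phi>. a \<phi> * (\<Prod>i\<in>UNIV. teichmueller (\<iota> (x $ i)) ^ u \<phi> i))"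
      unfolding prod.distrib a_def u_def power_sum by (subst prod.swap) simp
    finally show ?thesis .
  qed
  then have "annihilator \<iota> * (\<Sum>x\<in>UNIV. teichmueller_eval \<iota> g x ^ k) =
      annihilator \<iota> * (\<Sum>\<phi>\<in>\<Phi>. \<Sum>x\<in>(UNIV :: ('a ^ 'n) set). a \<phi> * (\<Prod>i\<in>UNIV. teichmueller (\<iota> (x $ i)) ^ u \<phi> i))"
    by (simp add: sum.swap[of _ _ \<Phi>])
  also have "\<dots> = (\<Sum>\<phi>\<in>\<Phi>. a \<phi> * (annihilator \<iota> *
      (\<Prod>i\<in>UNIV. \<Sum>t\<in>UNIV. teichmueller (\<iota> t) ^ u \<phi> i)))"
    unfolding sum_distrib_left[symmetric] sum_vec_prod[where h = "\<lambda>i t. teichmueller (\<iota> t) ^ u _ i"]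
    by (simp add: sum_distrib_left mult_ac)
  also have "of_nat CARD('a) dvd \<dots>"
  proof (rule dvd_sum, rule dvd_mult)
    fix \<phi> assume "\<phi> \<in> \<Phi>"
    then have \<phi>: "\<And>j. j < k \<Longrightarrow> \<phi> j \<in> Poly_Mapping.keys g" by (auto simp: \<Phi>_def)
    have "\<exists>i. u \<phi> i = 0 \<or> \<not> CARD('a) - 1 dvd u \<phi> i"
    proof (rule ccontr)
      assume "\<not> ?thesis"
      then have pos: "\<And>i. u \<phi> i > 0" and "\<forall>i. \<exists>w. u \<phi> i = (CARD('a) - 1) * w"
        by (auto elim: dvdE)
      then obtain w where w: "\<And>i. u \<phi> i = (CARD('a) - 1) * w i" by metis
      have "newton_mu g * ereal (real (CARD('a) - 1)) \<le> ereal (real k)"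
      proof (rule newton_mu_le[OF k _ \<phi>])
        show "w i > 0" for i using pos[of i] by (simp add: w)
      qed (use CARD_field_ge_2[where 'a = 'a] w in \<open>auto simp: u_def\<close>)
      with mu show False by simp
    qed
    then obtain i where i: "u \<phi> i = 0 \<or> \<not> CARD('a) - 1 dvd u \<phi> i" ..
    \<comment> \<open>One annihilator serves the whole product, since it is enough that the factor
      at \<open>i\<close> becomes divisible by q.\<close>
    have "(\<Sum>t\<in>UNIV. teichmueller (\<iota> t) ^ u \<phi> i) dvd (\<Prod>i\<in>UNIV. \<Sum>t\<in>UNIV. teichmueller (\<iota> t) ^ u \<phi> i)"
      by (rule dvd_prodI) auto
    with CARD_dvd_annihilator_power_sum[OF emb i]
    show "of_nat CARD('a) dvd annihilator \<iota> * (\<Prod>i\<in>UNIV. \<Sum>t\<in>UNIV. teichmueller (\<iota> t) ^ u \<phi> i)"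
      by (meson dvd_trans dvd_refl mult_dvd_mono)
  qed
  finally show ?thesis .
qed

lemma coeff_prod_mpoly_eval_eq_0:
  fixes \<iota> :: "'a::{field, finite} \<Rightarrow> 'b::{field, finite}" and g :: "('n::finite, 'b) mpoly"
  assumes emb: "field_embedding \<iota>" and k: "k > 0" "k < CARD('a)"
    and mu: "ereal (real k) < newton_mu g * ereal (real (CARD('a) - 1))"
  shows "coeff (\<Prod>x\<in>(UNIV :: ('a ^ 'n) set). [:1, - mpoly_eval g (\<chi> i. \<iota> (x $ i)):]) k = 0"
proof -
  define y where "y = teichmueller_eval \<iota> g"
  define E where "E = (\<Prod>x\<in>UNIV. [:1, - y x:])"
  define S where "S r = (\<Sum>x\<in>UNIV. y x ^ r)" for r
  obtain l where l: "k = Suc l" using k by (cases k) auto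
  have "of_nat k * (annihilator \<iota> * coeff E k) = annihilator \<iota> * (of_nat (Suc l) * coeff E (Suc l))"
    by (simp add: l mult_ac)
  also have "\<dots> = - (\<Sum>i\<le>l. coeff E i * (annihilator \<iota> * S (Suc (l - i))))"
    unfolding E_def S_def by (subst newton_identity, simp, subst mult_minus_right, subst sum_distrib_left)
      (simp add: mult.left_commute)
  finally have eq: "of_nat k * (annihilator \<iota> * coeff E k) = \<dots>" .
  \<comment> \<open>All power sums in Newton's identity have degree between 1 and \<open>k\<close>,
    so they inherit the bound \<open>mu\<close>.\<close>
  have "of_nat CARD('a) dvd annihilator \<iota> * S (Suc (l - i))" if "i \<le> l" for i
    unfolding S_def y_def
  proof (rule CARD_dvd_annihilator_power_sum_eval[OF emb])
    have "ereal (real (Suc (l - i))) \<le> ereal (real k)" by (simp add: l)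
    then show "ereal (real (Suc (l - i))) < newton_mu g * ereal (real (CARD('a) - 1))"
      using mu by (rule le_less_trans)
  qed simp
  then have "of_nat CARD('a) dvd of_nat k * (annihilator \<iota> * coeff E k)"
    unfolding eq dvd_minus_iff by (intro dvd_sum, rule dvd_mult) auto
  then obtain z where z: "of_nat k * (annihilator \<iota> * coeff E k) = of_nat CARD('a) * z" ..
  \<comment> \<open>q is a power of \<open>CHAR('a)\<close>, whereas \<open>reduction\<close> takes
    values in characteristic \<open>CHAR('b)\<close>.\<close>
  have "CHAR('a) = CHAR('b)"
  proof (rule CHAR_eqI)
    have of_nat: "\<iota> (of_nat r) = of_nat r" for r
      using emb field_embedding_0[OF emb] unfolding field_embedding_def by (induction r) auto
    show "of_nat CHAR('b) = (0 :: 'a)"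
      using field_embedding_eq_0_iff[OF emb, of "of_nat CHAR('b)"] by (simp add: of_nat)
    show "CHAR('b) dvd r" if "of_nat r = (0 :: 'a)" for r
      using of_nat[of r] that field_embedding_0[OF emb] by (simp add: of_nat_eq_0_iff_char_dvd)
  qed
  moreover obtain s where "CARD('a) = CHAR('a) ^ s" using CARD_finite_field_eq_power by blast
  ultimately have "reduction (annihilator \<iota> * coeff E k) = 0"
    by (intro reduction_eq_0_of_torsion[of _ s, OF _ k z]) simp
  \<comment> \<open>Only after reduction can the annihilator be cancelled: its image is a nonzero
    field element.\<close>
  then have "reduction (coeff E k) = 0"
    using reduction_annihilator[OF emb] by (simp add: reduction_mult)
  then show ?thesis
    by (simp add: E_def reduction_coeff_prod y_def reduction_teichmueller_eval)
qed

section \<open>From the polynomial vector to a single polynomial over the extension\<close>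

lemma mpoly_eval_combined_poly:
  fixes \<iota> :: "'a::field \<Rightarrow> 'b::field" and f :: "(('n::finite, 'a) mpoly) ^ 'n"
  assumes emb: "field_embedding \<iota>" and basis: "field_extension_basis \<iota> e"
  shows "mpoly_eval (combined_poly \<iota> e f) (\<chi> i. \<iota> (x $ i)) =
           (\<Sum>i\<in>UNIV. \<iota> (poly_vector_map f x $ i) * e i)"
proof -
  let ?K = "Poly_Mapping.keys (combined_poly \<iota> e f)"
  let ?m = "\<lambda>m. \<Prod>i\<in>UNIV. x $ i ^ Poly_Mapping.lookup m i"
  have mult: "\<iota> (a * b) = \<iota> a * \<iota> b" for a b using emb by (simp add: field_embedding_def)
  have ext: "mpoly_eval (f $ i) x = (\<Sum>m\<in>?K. Poly_Mapping.lookup (f $ i) m * ?m m)" for i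
    unfolding mpoly_eval_def using keys_combined_poly[OF emb basis, of f]
    by (intro sum.mono_neutral_left) (auto simp: in_keys_iff)
  have "mpoly_eval (combined_poly \<iota> e f) (\<chi> i. \<iota> (x $ i)) =
      (\<Sum>m\<in>?K. (\<Sum>i\<in>UNIV. \<iota> (Poly_Mapping.lookup (f $ i) m) * e i) * \<iota> (?m m))"
    unfolding mpoly_eval_def
    by (simp add: lookup_combined_poly[OF emb] field_embedding_prod[OF emb] field_embedding_power[OF emb])
  also have "\<dots> = (\<Sum>i\<in>UNIV. \<Sum>m\<in>?K. \<iota> (Poly_Mapping.lookup (f $ i) m * ?m m) * e i)"
    unfolding sum_distrib_right by (subst sum.swap) (simp add: mult mult_ac)
  also have "\<dots> = (\<Sum>i\<in>UNIV. \<iota> (poly_vector_map f x $ i) * e i)"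
    by (simp add: poly_vector_map_def ext field_embedding_sum[OF emb] sum_distrib_right)
  finally show ?thesis .
qed

text \<open>Linear independence makes coordinates unique, so the value set of \<open>f\<close> and
  that of the combined polynomial on embedded points have equal size.\<close>

lemma inj_basis_combination:
  fixes e :: "'n::finite \<Rightarrow> 'b::field" and \<iota> :: "'a::field \<Rightarrow> 'b"
  assumes emb: "field_embedding \<iota>" and basis: "field_extension_basis \<iota> e"
  shows "inj (\<lambda>y :: 'a ^ 'n. \<Sum>i\<in>UNIV. \<iota> (y $ i) * e i)"
proof (rule injI)
  have hom: "\<iota> 1 = 1" "\<iota> (x + y) = \<iota> x + \<iota> y" "\<iota> (x * y) = \<iota> x * \<iota> y" for x y
    using emb unfolding field_embedding_def by auto
  interpret module "\<lambda>c y. \<iota> c * y"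
    by unfold_locales (auto simp: hom algebra_simps)
  have inj: "inj e" and indep: "independent (e ` UNIV)"
    using basis unfolding field_extension_basis_def by auto
  fix y z :: "'a ^ 'n"
  assume "(\<Sum>i\<in>UNIV. \<iota> (y $ i) * e i) = (\<Sum>i\<in>UNIV. \<iota> (z $ i) * e i)"
  then have "(\<Sum>i\<in>UNIV. \<iota> (y $ i - z $ i) * e i) = 0"
    by (simp add: field_embedding_diff[OF emb] left_diff_distrib sum_subtractf)
  then have "(\<Sum>v\<in>e ` UNIV. \<iota> (y $ inv e v - z $ inv e v) * v) = 0"
    by (simp add: sum.reindex[OF inj] inj)
  then have "y $ inv e v - z $ inv e v = 0" if "v \<in> e ` UNIV" for v
    using independentD[OF indep, of "e ` UNIV" "\<lambda>v. y $ inv e v - z $ inv e v" v] that by simp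
  then show "y = z"
    by (metis inj inv_f_f rangeI vec_eq_iff right_minus_eq)
qed

theorem theorem1:
  fixes f :: "(('n::finite, 'a::{field, finite}) mpoly) ^ 'n"
    and \<iota> :: "'a \<Rightarrow> 'b::{field, finite}"
    and e :: "'n \<Rightarrow> 'b"
    and q n :: nat
  assumes q: "q = CARD('a)"
    and n: "n = CARD('n)"
    and extension: "CARD('b) = q ^ n" "field_embedding \<iota>"
    and basis: "field_extension_basis \<iota> e"
    and nonconstant: "n = 1 \<longrightarrow> (\<exists>i. \<not> Poly_Mapping.keys (f $ i) \<subseteq> {0})"
    and not_perm: "card (value_set f) < q ^ n"
  shows "ereal (real (card (value_set f))) \<le>
           ereal (real (q ^ n)) - min (ereal (real q)) (newton_mu_vector \<iota> e f * ereal (real q - 1))"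
proof -
  define g where "g = combined_poly \<iota> e f"
  define \<gamma> where "\<gamma> x = mpoly_eval g (\<chi> i. \<iota> (x $ i))" for x :: "'a ^ 'n"
  define \<mu> where "\<mu> = newton_mu g * ereal (real (q - 1))"
  have q2: "q \<ge> 2" unfolding q by (rule CARD_field_ge_2)
  have emb: "field_embedding \<iota>" by (rule extension)
  have "0 \<le> \<mu>" unfolding \<mu>_def using newton_mu_nonneg[of g] by (intro ereal_0_le_mult) auto
  \<comment> \<open>The minimum with \<open>q\<close> is finite even if \<mu> is infinite, so the
    counting can be done over the reals.\<close>
  then obtain M where M: "min (ereal (real q)) \<mu> = ereal M"
    by (intro that[of "real_of_ereal (min (ereal (real q)) \<mu>)"]) (cases \<mu>; auto simp: min_def)
  then have Mq: "M \<le> real q"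
    by (metis ereal_less_eq(3) min.cobounded1)
  have img: "\<gamma> ` UNIV = (\<lambda>y. \<Sum>i\<in>UNIV. \<iota> (y $ i) * e i) ` value_set f"
    unfolding value_set_def image_image \<gamma>_def g_def mpoly_eval_combined_poly[OF emb basis] ..
  then have card: "card (\<gamma> ` UNIV) = card (value_set f)"
    using inj_basis_combination[OF emb basis] by (simp add: card_image inj_on_subset)
  \<comment> \<open>Needed for \<open>card_image_le_of_coeffs_zero\<close>. For n >= 2 the bound q
    <= q^n - 1 is enough; for n = 1 it comes from \<open>newton_mu g\<close> <= 1.\<close>
  have "M \<le> real (q ^ n) - 1"
  proof (cases "n = 1")
    case True
    then obtain i m where m: "m \<in> Poly_Mapping.keys (f $ i)" "m \<noteq> 0" using nonconstant by auto
    then have mg: "m \<in> Poly_Mapping.keys g"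
      unfolding g_def keys_combined_poly[OF emb basis] by blast
    obtain i0 where i0: "(UNIV :: 'n set) = {i0}" using True n card_1_singletonE by metis
    obtain j where "Poly_Mapping.lookup m j \<noteq> 0" using m(2)
      by (metis lookup_zero poly_mapping_eqI)
    then have pos: "Poly_Mapping.lookup m i > 0" for i using i0 by (metis UNIV_I singletonD gr0I)
    \<comment> \<open>The only exponent of a nonconstant univariate monomial is positive, so
      \<open>m\<close> is itself a positive lattice point of the undilated polytope.\<close>
    have "newton_mu g * ereal (real 1) \<le> ereal (real 1)"
      by (rule newton_mu_le[where \<phi> = "\<lambda>_. m" and w = "Poly_Mapping.lookup m"]) (use mg pos in auto)
    then have "newton_mu g \<le> 1" by (simp add: one_ereal_def)
    then have "\<mu> \<le> 1 * ereal (real (q - 1))"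
      unfolding \<mu>_def by (intro ereal_mult_right_mono) auto
    then have "ereal M \<le> ereal (real (q - 1))" using M by (metis min.coboundedI2 mult_1)
    then show ?thesis using True q2 by (simp add: of_nat_diff)
  next
    case False
    then have "n \<ge> 2" using n by (metis One_nat_def Suc_1 Suc_leI le_neq_implies_less zero_less_card_finite)
    then have "q ^ 2 \<le> q ^ n" using q2 by (intro power_increasing) auto
    moreover have "q * 2 \<le> q ^ 2" using q2 by (simp add: power2_eq_square)
    ultimately have "q + 1 \<le> q ^ n" using q2 by linarith
    then show ?thesis using Mq by linarith
  qed
  then have "real (card (\<gamma> ` UNIV)) \<le> real CARD('b) - M"
  proof (intro card_image_le_of_coeffs_zero)
    show "card (UNIV :: ('a ^ 'n) set) = CARD('b)" by (simp add: extension q n)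
    show "coeff (\<Prod>v\<in>UNIV. [:1, - \<gamma> v:]) k = 0" if "0 < k" "real k < M" for k
    proof -
      have "ereal (real k) < min (ereal (real q)) \<mu>" using that by (simp add: M)
      then show ?thesis unfolding \<gamma>_def using that
        by (intro coeff_prod_mpoly_eval_eq_0[OF emb]) (auto simp: \<mu>_def q)
    qed
    show "\<gamma> ` UNIV \<noteq> UNIV" using card not_perm extension by (metis less_irrefl)
  qed (auto simp: extension)
  moreover have "newton_mu_vector \<iota> e f * ereal (real q - 1) = \<mu>"
    using q2 by (simp add: newton_mu_vector_def \<mu>_def g_def of_nat_diff)
  ultimately show ?thesis by (simp add: M card extension)
qed

end
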